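(* Let $\ell$ and $n$ be nonnegative integers and let $b$ be a complex number such that no zero factor appears in any denominator occurring in the identity below. Then $${}_3F_2\!\left[\begin{matrix}-n,\ \frac{3b}{2},\ \frac{1+3b}{2}\\ 3b+\ell,\ b-\frac{n-2}{3}\end{matrix}\,\Big|\,\frac43\right]=\frac{(3b+n)_n}{(\frac{1-2n}{3}-b)_n}\sum_{i=0}^{\ell}\frac{(-1)^i}{3^n}\,\frac{3b-1+2i}{3b-1}\,\frac{(-\ell)_i(-n)_i(3b-1)_i}{(1)_i(3b+n)_i(3b+\ell)_i}\cdot\frac{(\frac13)_{\frac{n-i}{3}}(\frac23)_{\frac{n-i}{3}}}{(\frac{2-2n-3b}{3})_{\frac{n-i}{3}}(\frac{3-2n-3b}{3})_{\frac{n-i}{3}}}\,\chi(n-i).$$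
   Context: For complex $x$ and an integer $m$, the shifted factorial is $(x)_m=\prod_{k=0}^{m-1}(x+k)$ for $m>0$, $(x)_0=1$, and $(x)_m=(-1)^m/\prod_{k=1}^{-m}(k-x)$ for $m<0$. The hypergeometric series is ${}_3F_2\!\left[\begin{matrix}a_0,a_1,a_2\\ b_1,b_2\end{matrix}\,\Big|\,z\right]=\sum_{k=0}^\infty\frac{(a_0)_k(a_1)_k(a_2)_k}{k!\,(b_1)_k(b_2)_k}z^k$, with parameters such that no zero factors appear in the denominators of the summand; with $a_0=-n$ it is a finite sum over $0\le k\le n$. For an integer $N$, $\chi(N)=1$ if $3\mid N$ and $\chi(N)=0$ otherwise; a summand containing $\chi(n-i)=0$ is understood to be $0$, so only indices $i$ with $(n-i)/3\in\mathbb Z$ contribute. *)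

theory Defs
  imports Complex_Main
begin

(* The library's pochhammer has a natural-number index; this is its extension to integer indices. *)
definition sfact :: "complex \<Rightarrow> int \<Rightarrow> complex" where
  "sfact x m =
     (if 0 \<le> m then pochhammer x (nat m)
      else (-1) powi m / (\<Prod>k=1..-m. (of_int k - x)))"

definition hyp3F2 ::
  "complex \<Rightarrow> complex \<Rightarrow> complex \<Rightarrow> complex \<Rightarrow> complex \<Rightarrow> complex \<Rightarrow> complex" where
  "hyp3F2 a0 a1 a2 b1 b2 z =
     (\<Sum>k. pochhammer a0 k * pochhammer a1 k * pochhammer a2 k
           / (fact k * pochhammer b1 k * pochhammer b2 k) * z ^ k)"

lemma hyp3F2_terminating:
  "hyp3F2 (- of_nat n) a1 a2 b1 b2 z =
     (\<Sum>k\<le>n. pochhammer (- of_nat n) k * pochhammer a1 k * pochhammer a2 k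
           / (fact k * pochhammer b1 k * pochhammer b2 k) * z ^ k)"
  unfolding hyp3F2_def
  by (rule suminf_finite) (auto simp: pochhammer_of_nat_eq_0_lemma)

definition chi :: "int \<Rightarrow> complex" where
  "chi N = (if 3 dvd N then 1 else 0)"

end

theory Submission
  imports Defs "HOL-Computational_Algebra.Polynomial"
begin

text \<open>
  Put \<open>a = 3b\<close>, so that the factors with argument \<open>4/3\<close> combine to \<open>(a)\<^bsub>2k\<^esub> / 3\<^bsup>k\<^esup>\<close>. For \<open>l = 0\<close>, after
  multiplication by the denominators, the series is a convolution of binomial coefficients that
  extracts the coefficient of \<open>y\<^bsup>n\<^esup>\<close> in
  \<open>(1 + y\<^sup>3)\<^bsup>c\<^esup> = ((1 + y)\<^sup>3 - 3y(1 + y))\<^bsup>c\<^esup>\<close>, where \<open>3c = a + 2n - 1\<close>; hence it vanishes unless \<open>3\<close> divides \<open>n\<close>.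
  For general \<open>l\<close>, the ratio \<open>(a)\<^bsub>k\<^esub> / (a + l)\<^bsub>k\<^esub>\<close> is the value of a terminating very-well-poised
  \<open>\<^sub>4F\<^sub>3(-1)\<close>. Inserting that sum and interchanging the summations turns the \<open>i\<close>-th inner sum into the
  case \<open>l = 0\<close> with \<open>(n, a)\<close> replaced by \<open>(n - i, a + 2i)\<close>, which leaves \<open>c\<close> unchanged.
\<close>

section \<open>Coefficient extraction and the case l = 0\<close>

lemma coeff_one_plus_monom_power:
  assumes "0 < d"
  shows "coeff ((1 + monom (1::'a::comm_semiring_1) d) ^ c) n =
    (if d dvd n then of_nat (c choose (n div d)) else 0)"
proof -
  have "(1 + monom (1::'a) d) ^ c = (\<Sum>k\<le>c. monom (of_nat (c choose k)) (d * k))"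
    by (subst add.commute, subst binomial_ring)
       (simp add: monom_power mult.commute of_nat_monom mult_monom)
  then have "coeff ((1 + monom (1::'a) d) ^ c) n =
      (\<Sum>k\<le>c. if d * k = n then of_nat (c choose k) else 0)"
    by (simp add: coeff_sum coeff_monom)
  also have "\<dots> = (if d dvd n then of_nat (c choose (n div d)) else 0)"
  proof (cases "d dvd n")
    case True
    then obtain q where "n = d * q" ..
    with assms show ?thesis by (simp add: sum.delta' binomial_eq_0)
  next
    case False
    then have "d * k \<noteq> n" for k by auto
    with False show ?thesis by simp
  qed
  finally show ?thesis .
qed

text \<open>Compare coefficients of y^n in (1 + y^3)^c, with 1 + y^3 rewritten as (1 + y)^3 - 3y(1 +
  y). The r-th term of the binomial expansion is a multiple of y^r (1 + y)^(3c - 2r), which accounts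
  for the second binomial coefficient.\<close>

lemma cubic_binomial_convolution_nat:
  "(\<Sum>r\<le>n. (of_nat c gchoose r) * (-3) ^ r * ((3 * of_nat c - 2 * of_nat r) gchoose (n - r))) =
     (if 3 dvd n then of_nat c gchoose (n div 3) else (0::'a::field_char_0))"
proof -
  let ?y = "monom (1::'a) 1"
  let ?f = "\<lambda>r. (of_nat c gchoose r) * (-3) ^ r * ((3 * of_nat c - 2 * of_nat r) gchoose (n - r)) :: 'a"
  have coeff_term: "coeff (of_nat (c choose r) * (- (3 * ?y * (1 + ?y))) ^ r * ((1 + ?y) ^ 3) ^ (c - r)) n =
      (if r \<le> n then ?f r else 0)"
    if "r \<le> c" for r
  proof -
    have "(- (3 * ?y * (1 + ?y))) ^ r = ([:-3:] * ?y * (1 + ?y)) ^ r"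
      by (simp add: numeral_poly)
    also have "\<dots> = monom ((-3) ^ r) r * (1 + ?y) ^ r"
      by (simp add: power_mult_distrib monom_power poly_const_pow smult_monom)
    finally have "of_nat (c choose r) * (- (3 * ?y * (1 + ?y))) ^ r * ((1 + ?y) ^ 3) ^ (c - r) =
        monom (of_nat (c choose r) * (-3) ^ r) r * (1 + ?y) ^ (r + 3 * (c - r))"
      by (simp add: power_add power_mult of_nat_poly mult.assoc flip: smult_monom)
    then show ?thesis
      using that by (simp add: coeff_monom_mult coeff_one_plus_monom_power binomial_gbinomial of_nat_diff algebra_simps del: One_nat_def)
  qed
  have "(if 3 dvd n then of_nat c gchoose (n div 3) else 0) = coeff ((1 + monom 1 3 :: 'a poly) ^ c) n"
    by (simp add: coeff_one_plus_monom_power binomial_gbinomial)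
  also have "(1 + monom 1 3 :: 'a poly) = - (3 * ?y * (1 + ?y)) + (1 + ?y) ^ 3"
  proof -
    have "monom 1 3 = ?y ^ 3" by (simp add: monom_power)
    then show ?thesis by (simp add: algebra_simps power3_eq_cube)
  qed
  also have "coeff (\<dots> ^ c) n =
      (\<Sum>r\<le>c. if r \<le> n then ?f r else 0)"
    unfolding binomial_ring[of "- (3 * ?y * (1 + ?y))"] coeff_sum
    by (intro sum.cong refl coeff_term) simp
  also have "\<dots> = (\<Sum>r\<le>n. ?f r)"
  proof -
    \<comment> \<open>For r > c the factor with upper argument 3c - 2r need not vanish, so the range
      of summation can be changed only because of the first factor.\<close>
    have z: "of_nat c gchoose r = (0::'a)" if "c < r" for r
      using that by (simp flip: binomial_gbinomial)
    have "(\<Sum>r\<le>c. if r \<le> n then ?f r else (0::'a)) =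
      (\<Sum>r\<in>{..c} \<inter> {..n}. ?f r)"
      by (subst sum.inter_restrict) auto
    also have "\<dots> = (\<Sum>r\<le>n. ?f r)"
      by (rule sum.mono_neutral_left) (auto simp: z)
    finally show ?thesis .
  qed
  finally show ?thesis by simp
qed

text \<open>For fixed n both sides are polynomials in c. They agree at every natural number, and a
  nonzero polynomial has only finitely many roots.\<close>

lemma cubic_binomial_convolution:
  fixes c :: "'a::field_char_0"
  shows "(\<Sum>r\<le>n. (c gchoose r) * (-3) ^ r * ((3 * c - 2 * of_nat r) gchoose (n - r))) =
     (if 3 dvd n then c gchoose (n div 3) else 0)"
proof -
  define B :: "'a \<Rightarrow> 'a \<Rightarrow> nat \<Rightarrow> 'a poly"
    where "B u v k = smult (1 / fact k) (\<Prod>i = 0..<k. [:u - of_nat i, v:])" for u v k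
  have B: "poly (B u v k) x = (u + v * x) gchoose k" for u v k x
    by (simp add: B_def gbinomial_prod_rev poly_prod algebra_simps)
  define P where "P = (\<Sum>r\<le>n. smult ((-3) ^ r) (B 0 1 r * B (- 2 * of_nat r) 3 (n - r)))
      - (if 3 dvd n then B 0 1 (n div 3) else 0)"
  have P: "poly P x = (\<Sum>r\<le>n. (x gchoose r) * (-3) ^ r * ((3 * x - 2 * of_nat r) gchoose (n - r)))
      - (if 3 dvd n then x gchoose (n div 3) else 0)" for x
    by (simp add: P_def poly_sum B algebra_simps)
  have "range of_nat \<subseteq> {x. poly P x = 0}"
    using cubic_binomial_convolution_nat[where ?'a = 'a and n = n] by (auto simp: P)
  moreover have "infinite (range (of_nat :: nat \<Rightarrow> 'a))"
    by (simp add: range_inj_infinite inj_of_nat)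
  ultimately have "P = 0"
    using poly_roots_finite finite_subset by blast
  with P[of c] show ?thesis by simp
qed

text \<open>The left side is the series for l = 0 with denominators cleared:
  \<open>pochhammer (a + of_nat k) k\<close> stands for (a)_2k / (a)_k, and the last factor for the
  quotient of ((a - n + 2)/3)_n by ((a - n + 2)/3)_k. Reversing the order of summation turns it into
  the cubic convolution.\<close>

lemma gessel_stanton_sum:
  fixes a :: "'a::field_char_0"
  shows "(\<Sum>k\<le>n. pochhammer (- of_nat n) k / fact k * pochhammer (a + of_nat k) k *
        3 ^ (n - k) * pochhammer ((a - of_nat n + 2) / 3 + of_nat k) (n - k)) =
     (-1) ^ n * fact n * (if 3 dvd n then ((a + 2 * of_nat n - 1) / 3) gchoose (n div 3) else 0)"
proof -
  \<comment> \<open>This value fits both binomial coefficients: for n = r + s their rising products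
    start at c - r + 1 = (a - n + 2)/3 + s and at 3c - 2r - s + 1 = a + s.\<close>
  define c where "c = (a + 2 * of_nat n - 1) / 3"
  have "(\<Sum>k\<le>n. pochhammer (- of_nat n) k / fact k * pochhammer (a + of_nat k) k *
        3 ^ (n - k) * pochhammer ((a - of_nat n + 2) / 3 + of_nat k) (n - k)) =
      (\<Sum>r\<le>n. pochhammer (- of_nat n) (n - r) / fact (n - r) * pochhammer (a + of_nat (n - r)) (n - r) *
        3 ^ (n - (n - r)) * pochhammer ((a - of_nat n + 2) / 3 + of_nat (n - r)) (n - (n - r)))"
    by (rule sum.reindex_bij_witness[of _ "\<lambda>r. n - r" "\<lambda>k. n - k"]) auto
  also have "\<dots> = (\<Sum>r\<le>n. (-1) ^ n * fact n *
      ((c gchoose r) * (-3) ^ r * ((3 * c - 2 * of_nat r) gchoose (n - r))))"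
  proof (rule sum.cong)
    fix r assume "r \<in> {..n}"
    then obtain s where s: "n = r + s" by (auto simp: le_iff_add)
    have 1: "c - of_nat r + 1 = (a - of_nat n + 2) / 3 + of_nat s"
      by (simp add: c_def s field_simps)
    have 2: "3 * c - 2 * of_nat r - of_nat s + 1 = a + of_nat s"
      by (simp add: c_def s field_simps)
    have 3: "pochhammer (- of_nat n) s = (-1) ^ s * (fact n / fact r :: 'a)"
    proof -
      have "pochhammer (1 :: 'a) (r + s) = pochhammer 1 r * pochhammer (1 + of_nat r) s"
        by (rule pochhammer_product')
      then show ?thesis
        unfolding pochhammer_minus s by (simp add: pochhammer_fact[symmetric] add.commute)
    qed
    have 4: "(-3) ^ r = (-1) ^ r * (3 :: 'a) ^ r"
      by (simp flip: power_mult_distrib)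
    have 5: "(-1) ^ n * (-1) ^ r = ((-1) ^ s :: 'a)"
      by (simp add: s power_add flip: power_mult_distrib)
    have nr: "n - r = s" "n - s = r" using s by auto
    show "pochhammer (- of_nat n) (n - r) / fact (n - r) * pochhammer (a + of_nat (n - r)) (n - r) *
        3 ^ (n - (n - r)) * pochhammer ((a - of_nat n + 2) / 3 + of_nat (n - r)) (n - (n - r)) =
      (-1) ^ n * fact n *
      ((c gchoose r) * (-3) ^ r * ((3 * c - 2 * of_nat r) gchoose (n - r)))"
      unfolding gbinomial_pochhammer'[of c] gbinomial_pochhammer'[of "3 * c - 2 * of_nat r"]
        nr 1 2 3 4 5[symmetric] by (simp add: mult_ac)
  qed simp
  also have "\<dots> = (-1) ^ n * fact n * (if 3 dvd n then c gchoose (n div 3) else 0)"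
    by (simp only: sum_distrib_left[symmetric] cubic_binomial_convolution)
  finally show ?thesis by (simp add: c_def)
qed

section \<open>The very-well-poised expansion\<close>

text \<open>
  The factor \<open>(a)\<^bsub>i-1\<^esub>\<close> stands for \<open>(a - 1)\<^bsub>i\<^esub> / (a - 1)\<close>; this form remains meaningful at \<open>a = 1\<close>.
\<close>

definition vwp_weight :: "'a::field_char_0 \<Rightarrow> nat \<Rightarrow> 'a" where
  "vwp_weight a i = (if i = 0 then 1 else (a - 1 + 2 * of_nat i) * pochhammer a (i - 1))"

lemma vwp_weight_eq:
  assumes "a \<noteq> 1"
  shows "vwp_weight a i = (a - 1 + 2 * of_nat i) / (a - 1) * pochhammer (a - 1) i"
  using assms by (cases i) (simp_all add: vwp_weight_def pochhammer_rec)

text \<open>Division by \<open>pochhammer (a + x) k\<close> and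
  \<open>pochhammer (a + of_nat k) k\<close> gives the terminating very-well-poised 4F3(-1) with
  value (a)_k / (a + x)_k. The form without denominators holds for all a and x. The induction on k
  rests on a telescoping recurrence for the summands.\<close>

lemma vwp_expansion:
  fixes a x :: "'a::field_char_0"
  shows "(\<Sum>i\<le>k. of_nat (k choose i) * vwp_weight a i * pochhammer (- x) i *
      pochhammer (a + x + of_nat i) (k - i) * pochhammer (a + of_nat k + of_nat i) (k - i)) =
    pochhammer a (2 * k)"
proof (induction k)
  case 0
  show ?case by (simp add: vwp_weight_def)
next
  case (Suc k)
  define T where "T k i = of_nat (k choose i) * vwp_weight a i * pochhammer (- x) i *
      pochhammer (a + x + of_nat i) (k - i) * pochhammer (a + of_nat k + of_nat i) (k - i)" for k i
  \<comment> \<open>\<open>H\<close> is the Gosper certificate for the recurrence of \<open>T\<close> in \<open>k\<close>, cleared of denominators.\<close>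
  define H where "H i = (if i = 0 then 0 else
      - of_nat (k choose (i - 1)) * pochhammer a (i - 1) * pochhammer (- x) i *
      pochhammer (a + x + of_nat i - 1) (Suc k - i) * pochhammer (a + of_nat k + of_nat i) (Suc (Suc k) - i))"
    for i
  \<comment> \<open>The ratio of the right-hand sides for k + 1 and k.\<close>
  let ?q = "(a + 2 * of_nat k) * (a + 2 * of_nat k + 1)"
  have step: "T (Suc k) i - ?q * T k i = H (Suc i) - H i" if "i \<le> k" for i
  \<comment> \<open>The index 0 stands apart because truncated subtraction would read the binomial
    coefficient of k over -1 in \<open>H\<close> as 1, and because \<open>vwp_weight\<close> has a
    separate value there.\<close>
  proof (cases i)
    case 0
    have A: "pochhammer (a + x) (Suc k) = pochhammer (a + x) k * (a + x + of_nat k)"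
      by (simp add: pochhammer_Suc)
    have B: "pochhammer (a + of_nat k + 1) (Suc k) = pochhammer (a + of_nat k + 1) k * (a + 2 * of_nat k + 1)"
      by (simp add: pochhammer_Suc algebra_simps)
    have C: "pochhammer (a + of_nat k) k * ?q = (a + of_nat k) * pochhammer (a + of_nat k + 1) k * (a + 2 * of_nat k + 1)"
    proof -
      have "pochhammer (a + of_nat k) k * (a + 2 * of_nat k) = (a + of_nat k) * pochhammer (a + of_nat k + 1) k"
        using pochhammer_rec[of "a + of_nat k" k] pochhammer_rec'[of "a + of_nat k" k]
        by (simp add: algebra_simps)
      then show ?thesis by (simp add: mult.assoc)
    qed
    have "T (Suc k) i - ?q * T k i = pochhammer (a + x) k * (a + x + of_nat k) *
        (pochhammer (a + of_nat k + 1) k * (a + 2 * of_nat k + 1)) -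
        pochhammer (a + x) k * (pochhammer (a + of_nat k) k * ?q)"
      using 0 A B by (simp add: T_def vwp_weight_def add_ac mult_ac)
    also have "\<dots> = x * pochhammer (a + x) k * (pochhammer (a + of_nat k + 1) k * (a + 2 * of_nat k + 1))"
      unfolding C by (simp add: algebra_simps)
    also have "\<dots> = H (Suc i) - H i"
      using 0 B by (simp add: H_def add_ac mult_ac)
    finally show ?thesis .
  next
    case (Suc j)
    from that obtain M where M: "k = i + M" by (auto simp: le_iff_add)
    \<comment> \<open>All four terms of the recurrence are multiples of R X P Q (a + 2k + 1); only
      low-degree cofactors remain to be compared.\<close>
    define P where "P = pochhammer (a + x + of_nat i) M"
    define Q where "Q = pochhammer (a + of_nat k + of_nat i + 1) M"
    define R where "R = pochhammer a j"
    define X where "X = pochhammer (- x) i"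
    define u v where "u = (of_nat (k choose j) :: 'a)" and "v = (of_nat (k choose i) :: 'a)"
    have uv: "of_nat i * v = of_nat (Suc M) * u"
    proof -
      have "k - j = Suc M" using Suc M by simp
      then have "i * (k choose i) = Suc M * (k choose j)"
        using binomial_absorb_comp[of k j] binomial_absorption[of j k] by (simp only: Suc)
      then show ?thesis
        unfolding u_def v_def of_nat_mult[symmetric] by (rule arg_cong)
    qed
    have w: "vwp_weight a i = (a - 1 + 2 * of_nat i) * R"
      by (simp add: vwp_weight_def Suc R_def)
    have choose: "of_nat (Suc k choose i) = u + v"
      by (simp add: Suc u_def v_def)
    have dM: "k - i = M" "Suc k - i = Suc M" using M by auto
    have T1: "T (Suc k) i = (u + v) * ((a - 1 + 2 * of_nat i) * R) * X *
        (P * (a + x + of_nat k)) * (Q * (a + 2 * of_nat k + 1))"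
      unfolding T_def w choose dM pochhammer_Suc
      by (simp add: X_def P_def Q_def M add_ac)
    have Q': "pochhammer (a + of_nat k + of_nat i) M * (a + 2 * of_nat k) = (a + of_nat k + of_nat i) * Q"
      using pochhammer_rec[of "a + of_nat k + of_nat i" M] pochhammer_rec'[of "a + of_nat k + of_nat i" M]
      by (simp add: Q_def M algebra_simps)
    have "?q * T k i = v * ((a - 1 + 2 * of_nat i) * R) * X * P *
        (pochhammer (a + of_nat k + of_nat i) M * (a + 2 * of_nat k)) * (a + 2 * of_nat k + 1)"
      unfolding T_def w dM by (simp add: v_def X_def P_def mult_ac)
    then have T2: "?q * T k i = v * ((a - 1 + 2 * of_nat i) * R) * X * P *
        ((a + of_nat k + of_nat i) * Q) * (a + 2 * of_nat k + 1)"
      by (simp only: Q')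
    have H1: "H (Suc i) = - v * (R * (a + of_nat i - 1)) * (X * (of_nat i - x)) * P * (Q * (a + 2 * of_nat k + 1))"
    proof -
      have "H (Suc i) = - v * pochhammer a i * pochhammer (- x) (Suc i) * P *
          pochhammer (a + of_nat k + of_nat i + 1) (Suc M)"
        using dM by (simp add: H_def v_def P_def add_ac)
      also have "pochhammer a i = R * (a + of_nat i - 1)"
        by (simp add: Suc pochhammer_Suc R_def)
      also have "pochhammer (- x) (Suc i) = X * (of_nat i - x)"
        by (simp add: pochhammer_Suc X_def)
      also have "pochhammer (a + of_nat k + of_nat i + 1) (Suc M) = Q * (a + 2 * of_nat k + 1)"
        by (simp add: pochhammer_Suc Q_def M add_ac)
      finally show ?thesis .
    qed
    have H2: "H i = - u * R * X * ((a + x + of_nat i - 1) * P) * ((a + of_nat k + of_nat i) * (Q * (a + 2 * of_nat k + 1)))"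
    proof -
      have "pochhammer (a + x + of_nat i - 1) (Suc M) = (a + x + of_nat i - 1) * P"
        by (simp add: pochhammer_rec P_def)
      moreover have "pochhammer (a + of_nat k + of_nat i) (Suc (Suc M)) =
          (a + of_nat k + of_nat i) * (Q * (a + 2 * of_nat k + 1))"
        unfolding pochhammer_rec[of _ "Suc M"] by (simp add: pochhammer_Suc Q_def M add_ac)
      moreover have "Suc k - i = Suc M" "Suc (Suc k) - i = Suc (Suc M)" "i \<noteq> 0" "i - 1 = j"
        using Suc M by auto
      ultimately show ?thesis
        by (simp add: H_def u_def R_def X_def)
    qed
    \<comment> \<open>The difference of the two cofactors is a multiple of i v - (M + 1) u, which
      \<open>uv\<close> makes zero.\<close>
    have "(u + v) * (a - 1 + 2 * of_nat i) * (a + x + of_nat k) - v * (a - 1 + 2 * of_nat i) * (a + of_nat k + of_nat i) -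
        (- v * (a + of_nat i - 1) * (of_nat i - x) + u * (a + x + of_nat i - 1) * (a + of_nat k + of_nat i)) =
        (x - of_nat i) * (of_nat i * v - of_nat (Suc M) * u)"
      by (simp add: M algebra_simps)
    then have key: "(u + v) * (a - 1 + 2 * of_nat i) * (a + x + of_nat k) - v * (a - 1 + 2 * of_nat i) * (a + of_nat k + of_nat i) =
        - v * (a + of_nat i - 1) * (of_nat i - x) + u * (a + x + of_nat i - 1) * (a + of_nat k + of_nat i)"
      by (simp add: uv)
    have "T (Suc k) i - ?q * T k i = ((u + v) * (a - 1 + 2 * of_nat i) * (a + x + of_nat k) -
        v * (a - 1 + 2 * of_nat i) * (a + of_nat k + of_nat i)) * (R * X * P * Q * (a + 2 * of_nat k + 1))"
      unfolding T1 T2 left_diff_distrib by (simp only: mult_ac)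
    also have "\<dots> = H (Suc i) - H i"
    proof -
      have "(- v * A * B + u * C * D) * (R * X * P * Q * E) =
          - v * (R * A) * (X * B) * P * (Q * E) - (- u * R * X * (C * P) * (D * (Q * E)))" for A B C D E
        by (simp add: algebra_simps)
      then show ?thesis unfolding key H1 H2 .
    qed
    finally show ?thesis .
  qed
  have "(\<Sum>i\<le>Suc k. T (Suc k) i) = (\<Sum>i\<le>k. T (Suc k) i) + T (Suc k) (Suc k)"
    by simp
  also have "(\<Sum>i\<le>k. T (Suc k) i) = (\<Sum>i\<le>k. ?q * T k i + (H (Suc i) - H i))"
    using step by (intro sum.cong) (auto simp: algebra_simps)
  also have "\<dots> = ?q * (\<Sum>i\<le>k. T k i) + (H (Suc k) - H 0)"
    using sum_lessThan_telescope[of H "Suc k"]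
    by (simp add: sum.distrib lessThan_Suc_atMost flip: sum_distrib_left)
  \<comment> \<open>The recurrence covers only i \<le> k. The new top summand cancels the boundary
    value left by the telescoping.\<close>
  also have "T (Suc k) (Suc k) = - H (Suc k)"
    by (simp add: T_def H_def vwp_weight_def algebra_simps)
  also have "(\<Sum>i\<le>k. T k i) = pochhammer a (2 * k)"
    using Suc.IH by (simp add: T_def)
  also have "?q * pochhammer a (2 * k) + (H (Suc k) - H 0) + - H (Suc k) = pochhammer a (2 * Suc k)"
    by (simp add: H_def pochhammer_Suc mult_ac add_ac)
  finally show ?case by (simp add: T_def)
qed

section \<open>Triplication, interchange of summations and the quotient form\<close>

lemma pochhammer_triple:
  fixes z :: "'a::field_char_0"
  shows "pochhammer z (3 * m) = 27 ^ m * pochhammer (z / 3) m * pochhammer ((z + 1) / 3) m * pochhammer ((z + 2) / 3) m"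
proof (induction m)
  case (Suc m)
  have "pochhammer z (3 * Suc m) = pochhammer z (3 * m) *
      ((z + 3 * of_nat m) * (z + 3 * of_nat m + 1) * (z + 3 * of_nat m + 2))"
    by (simp add: pochhammer_Suc eval_nat_numeral add_ac mult_ac)
  also have "(z + 3 * of_nat m) * (z + 3 * of_nat m + 1) * (z + 3 * of_nat m + 2) =
      27 * (z / 3 + of_nat m) * ((z + 1) / 3 + of_nat m) * ((z + 2) / 3 + of_nat m)"
    by (simp add: field_simps)
  finally show ?case
    unfolding Suc.IH pochhammer_Suc power_Suc by (simp only: mult_ac)
qed simp


text \<open>Inserting \<open>vwp_expansion\<close> gives a sum over the triangle i \<le> k \<le> n.
  For fixed i, with j = k - i, the inner sum is an instance of \<open>gessel_stanton_sum\<close>.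
  The parameter x later becomes l.\<close>

lemma strange_sum_expansion:
  fixes a x :: "'a::field_char_0"
  assumes nz: "\<And>k. k \<le> n \<Longrightarrow> pochhammer (a + x) k \<noteq> 0"
  shows "(\<Sum>k\<le>n. pochhammer (- of_nat n) k / fact k * (pochhammer a (2 * k) / pochhammer (a + x) k) *
        3 ^ (n - k) * pochhammer ((a - of_nat n + 2) / 3 + of_nat k) (n - k)) =
    (\<Sum>i\<le>n. vwp_weight a i * pochhammer (- x) i * pochhammer (- of_nat n) i / (fact i * pochhammer (a + x) i) *
        ((-1) ^ (n - i) * fact (n - i) *
         (if 3 dvd n - i then ((a + 2 * of_nat n - 1) / 3) gchoose ((n - i) div 3) else 0)))"
proof -
  define d where "d i = vwp_weight a i * pochhammer (- x) i * pochhammer (- of_nat n) i /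
    (fact i * pochhammer (a + x) i)" for i
  \<comment> \<open>The j-th summand of \<open>gessel_stanton_sum\<close> with n - i for n and a +
    2i for a.\<close>
  define e where "e i j = pochhammer (- of_nat (n - i)) j / fact j *
      pochhammer ((a + 2 * of_nat i) + of_nat j) j * 3 ^ (n - i - j) *
      pochhammer ((a + 2 * of_nat i - of_nat (n - i) + 2) / 3 + of_nat j) (n - i - j)" for i j
  have "pochhammer (- of_nat n) k / fact k * (pochhammer a (2 * k) / pochhammer (a + x) k) *
        3 ^ (n - k) * pochhammer ((a - of_nat n + 2) / 3 + of_nat k) (n - k) =
      (\<Sum>i\<le>k. d i * e i (k - i))" (is "?L = _") if k: "k \<le> n" for k
  proof -
    have "?L = (\<Sum>i\<le>k. pochhammer (- of_nat n) k / fact k *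
        (of_nat (k choose i) * vwp_weight a i * pochhammer (- x) i *
        pochhammer (a + x + of_nat i) (k - i) * pochhammer (a + of_nat k + of_nat i) (k - i) /
        pochhammer (a + x) k) *
        3 ^ (n - k) * pochhammer ((a - of_nat n + 2) / 3 + of_nat k) (n - k))"
      unfolding vwp_expansion[of k a x, symmetric]
      by (simp only: sum_distrib_left sum_distrib_right sum_divide_distrib)
    also have "\<dots> = (\<Sum>i\<le>k. d i * e i (k - i))"
    proof (rule sum.cong)
      fix i assume "i \<in> {..k}"
      then obtain j where j: "k = i + j" by (auto simp: le_iff_add)
      obtain m where m: "n = i + j + m" using k j by (auto simp: le_iff_add)
      have 1: "pochhammer (- of_nat n) k = pochhammer (- of_nat n) i * (pochhammer (- of_nat (n - i)) j :: 'a)"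
        unfolding j pochhammer_product' by (simp add: m)
      have 2: "pochhammer (a + x + of_nat i) (k - i) / pochhammer (a + x) k = 1 / pochhammer (a + x) i"
        using nz[OF k] unfolding j pochhammer_product' by simp
      have 3: "of_nat (k choose i) / fact k = (1 / (fact i * fact j) :: 'a)"
        by (simp add: j binomial_fact)
      \<comment> \<open>Passing from k to j = k - i offsets the changes of a and n, so the last
        factor does not depend on i.\<close>
      have 4: "(a + 2 * of_nat i - of_nat (n - i) + 2) / 3 + of_nat j = (a - of_nat n + 2) / 3 + of_nat k"
        by (simp add: m j field_simps)
      have 5: "a + of_nat k + of_nat i = a + 2 * of_nat i + of_nat j"
        by (simp add: j)
      have ij: "k - i = j" "n - i - j = n - k" using j by auto
      have "d i * e i (k - i) = pochhammer (- of_nat n) k * (1 / (fact i * fact j)) *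
        (vwp_weight a i * pochhammer (- x) i) * (1 / pochhammer (a + x) i) * pochhammer (a + 2 * of_nat i + of_nat j) j *
        3 ^ (n - k) * pochhammer ((a - of_nat n + 2) / 3 + of_nat k) (n - k)"
        unfolding 1 d_def e_def ij 4 by (simp add: mult_ac)
      also have "\<dots> = pochhammer (- of_nat n) k / fact k *
        (of_nat (k choose i) * vwp_weight a i * pochhammer (- x) i *
        pochhammer (a + x + of_nat i) (k - i) * pochhammer (a + of_nat k + of_nat i) (k - i) /
        pochhammer (a + x) k) *
        3 ^ (n - k) * pochhammer ((a - of_nat n + 2) / 3 + of_nat k) (n - k)"
        unfolding 2[symmetric] 3[symmetric] 5 by (simp add: j)
      finally show "pochhammer (- of_nat n) k / fact k *
        (of_nat (k choose i) * vwp_weight a i * pochhammer (- x) i *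
        pochhammer (a + x + of_nat i) (k - i) * pochhammer (a + of_nat k + of_nat i) (k - i) /
        pochhammer (a + x) k) *
        3 ^ (n - k) * pochhammer ((a - of_nat n + 2) / 3 + of_nat k) (n - k) = d i * e i (k - i)" ..
    qed simp
    finally show ?thesis .
  qed
  then have "(\<Sum>k\<le>n. pochhammer (- of_nat n) k / fact k * (pochhammer a (2 * k) / pochhammer (a + x) k) *
        3 ^ (n - k) * pochhammer ((a - of_nat n + 2) / 3 + of_nat k) (n - k)) =
      (\<Sum>k\<le>n. \<Sum>i\<le>k. d i * e i (k - i))"
    by simp
  also have "\<dots> = (\<Sum>(i, j)\<in>{(i, j). i + j \<le> n}. d i * e i j)"
    by (rule sum.triangle_reindex_eq[symmetric])
  also have "{(i, j). i + j \<le> n} = Sigma {..n} (\<lambda>i. {..n - i})"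
    by auto
  also have "(\<Sum>(i, j)\<in>Sigma {..n} (\<lambda>i. {..n - i}). d i * e i j) = (\<Sum>i\<le>n. d i * (\<Sum>j\<le>n - i. e i j))"
    by (simp add: sum.Sigma sum_distrib_left)
  also have "\<dots> = (\<Sum>i\<le>n. d i * ((-1) ^ (n - i) * fact (n - i) *
         (if 3 dvd n - i then ((a + 2 * of_nat n - 1) / 3) gchoose ((n - i) div 3) else 0)))"
  proof (rule sum.cong)
    fix i assume "i \<in> {..n}"
    then have "a + 2 * of_nat i + 2 * of_nat (n - i) - 1 = a + 2 * of_nat n - 1"
      by (simp add: of_nat_diff)
    with gessel_stanton_sum[of "n - i" "a + 2 * of_nat i"]
    show "d i * (\<Sum>j\<le>n - i. e i j) = d i * ((-1) ^ (n - i) * fact (n - i) *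
         (if 3 dvd n - i then ((a + 2 * of_nat n - 1) / 3) gchoose ((n - i) div 3) else 0))"
      by (simp only: e_def)
  qed simp
  finally show ?thesis by (simp only: d_def)
qed

text \<open>Triplication splits both (3m)! and the last 3m factors of (a + n)_n into three products
  each. Two products of the latter are, up to sign, the reversed denominators; the third is m! times
  the binomial coefficient.\<close>

lemma fact_gbinomial_eq_pochhammer_quotient:
  fixes a :: "'a::field_char_0"
  assumes n: "n = i + 3 * m"
    and "pochhammer ((2 - 2 * of_nat n - a) / 3) m \<noteq> 0" "pochhammer ((3 - 2 * of_nat n - a) / 3) m \<noteq> 0"
    and "pochhammer (a + of_nat n) i \<noteq> 0"
  shows "fact (3 * m) * (((a + 2 * of_nat n - 1) / 3) gchoose m) =
    pochhammer (a + of_nat n) n / pochhammer (a + of_nat n) i *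
    (pochhammer (1 / 3) m * pochhammer (2 / 3) m /
     (pochhammer ((2 - 2 * of_nat n - a) / 3) m * pochhammer ((3 - 2 * of_nat n - a) / 3) m))"
proof -
  \<comment> \<open>The point where (a + n)_n continues once its first i factors are removed; n - i
    = 3m factors remain.\<close>
  define c where "c = a + of_nat n + of_nat i"
  have e1: "pochhammer (a + of_nat n) n = pochhammer (a + of_nat n) i * pochhammer c (3 * m)"
    unfolding c_def using pochhammer_product'[of "a + of_nat n" i "3 * m"] n by simp
  have e2: "pochhammer ((2 - 2 * of_nat n - a) / 3) m = (-1) ^ m * pochhammer ((c + 1) / 3) m"
  proof -
    have "(2 - 2 * of_nat n - a) / 3 = - ((a + 2 * of_nat n - 2) / 3)" by (simp add: field_simps)
    moreover have "(a + 2 * of_nat n - 2) / 3 - of_nat m + 1 = (c + 1) / 3"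
      by (simp add: c_def n field_simps)
    ultimately show ?thesis by (simp only: pochhammer_minus)
  qed
  have e3: "pochhammer ((3 - 2 * of_nat n - a) / 3) m = (-1) ^ m * pochhammer (c / 3) m"
  proof -
    have "(3 - 2 * of_nat n - a) / 3 = - ((a + 2 * of_nat n - 3) / 3)" by (simp add: field_simps)
    moreover have "(a + 2 * of_nat n - 3) / 3 - of_nat m + 1 = c / 3"
      by (simp add: c_def n field_simps)
    ultimately show ?thesis by (simp only: pochhammer_minus)
  qed
  have e4: "(fact (3 * m) :: 'a) = 27 ^ m * pochhammer (1 / 3) m * pochhammer (2 / 3) m * fact m"
    using pochhammer_triple[of "1 :: 'a" m] by (simp add: pochhammer_fact)
  have e5: "((a + 2 * of_nat n - 1) / 3) gchoose m = pochhammer ((c + 2) / 3) m / fact m"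
  proof -
    have "(a + 2 * of_nat n - 1) / 3 - of_nat m + 1 = (c + 2) / 3"
      by (simp add: c_def n field_simps)
    then show ?thesis by (simp only: gbinomial_pochhammer')
  qed
  have e6: "(-1) ^ m * u * ((-1) ^ m * v) = u * v" for u v :: 'a
    by (simp add: mult_ac flip: power_mult_distrib)
  have "pochhammer ((c + 1) / 3) m \<noteq> 0" "pochhammer (c / 3) m \<noteq> 0"
    using assms(2,3) unfolding e2 e3 by auto
  then show ?thesis
    using assms(4) unfolding e1 e2 e3 e4 e5 e6 pochhammer_triple[of c] by simp
qed

section \<open>The identity with its denominators restored\<close>

theorem theorem6:
  fixes l n :: nat and b :: complex
  assumes "\<And>k. k \<le> n \<Longrightarrow> pochhammer (3 * b + of_nat l) k \<noteq> 0"
    and "\<And>k. k \<le> n \<Longrightarrow> pochhammer (b - (of_nat n - 2) / 3) k \<noteq> 0"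
    and "pochhammer ((1 - 2 * of_nat n) / 3 - b) n \<noteq> 0"
    and "\<And>i. i \<le> l \<Longrightarrow> 3 dvd int n - int i \<Longrightarrow> 3 * b - 1 \<noteq> 0"
    and "\<And>i. i \<le> l \<Longrightarrow> 3 dvd int n - int i \<Longrightarrow> pochhammer (3 * b + of_nat n) i \<noteq> 0"
    and "\<And>i. i \<le> l \<Longrightarrow> 3 dvd int n - int i \<Longrightarrow> pochhammer (3 * b + of_nat l) i \<noteq> 0"
    and "\<And>i. i \<le> l \<Longrightarrow> 3 dvd int n - int i \<Longrightarrow>
           sfact ((2 - 2 * of_nat n - 3 * b) / 3) ((int n - int i) div 3) \<noteq> 0"
    and "\<And>i. i \<le> l \<Longrightarrow> 3 dvd int n - int i \<Longrightarrow>
           sfact ((3 - 2 * of_nat n - 3 * b) / 3) ((int n - int i) div 3) \<noteq> 0"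
  shows "hyp3F2 (- of_nat n) (3 * b / 2) ((1 + 3 * b) / 2)
                (3 * b + of_nat l) (b - (of_nat n - 2) / 3) (4 / 3) =
         pochhammer (3 * b + of_nat n) n / pochhammer ((1 - 2 * of_nat n) / 3 - b) n *
         (\<Sum>i=0..l. (-1) ^ i / 3 ^ n * ((3 * b - 1 + 2 * of_nat i) / (3 * b - 1)) *
            (pochhammer (- of_nat l) i * pochhammer (- of_nat n) i * pochhammer (3 * b - 1) i /
             (pochhammer 1 i * pochhammer (3 * b + of_nat n) i * pochhammer (3 * b + of_nat l) i)) *
            (sfact (1 / 3) ((int n - int i) div 3) * sfact (2 / 3) ((int n - int i) div 3) /
             (sfact ((2 - 2 * of_nat n - 3 * b) / 3) ((int n - int i) div 3) *
              sfact ((3 - 2 * of_nat n - 3 * b) / 3) ((int n - int i) div 3))) *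
            chi (int n - int i))"
proof -
  define a where "a = 3 * b"
  \<comment> \<open>Multiplication by \<open>p\<close> clears the second lower parameter and the
    powers of 3 in the denominators of the series.\<close>
  define p where "p = 3 ^ n * pochhammer ((a - of_nat n + 2) / 3) n"
  have beta: "b - (of_nat n - 2) / 3 = (a - of_nat n + 2) / 3"
    by (simp add: a_def field_simps)
  have nzl: "pochhammer (a + of_nat l) k \<noteq> 0" if "k \<le> n" for k
    using assms(1) that by (simp add: a_def)
  have nzb: "pochhammer ((a - of_nat n + 2) / 3) k \<noteq> 0" if "k \<le> n" for k
    using assms(2) that by (simp add: beta)
  have p: "p \<noteq> 0"
    using nzb[of n] by (simp add: p_def)
  \<comment> \<open>Reversing the factors shows that the denominator of the prefactor, together with
    the 3^n under each summand, is \<open>p\<close> up to sign.\<close>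
  have prefactor: "3 ^ n * pochhammer ((1 - 2 * of_nat n) / 3 - b) n = (-1) ^ n * p"
  proof -
    have "(1 - 2 * of_nat n) / 3 - b = - (b - (1 - 2 * of_nat n) / 3)" by simp
    moreover have "b - (1 - 2 * of_nat n) / 3 - of_nat n + 1 = (a - of_nat n + 2) / 3"
      by (simp add: a_def field_simps)
    ultimately show ?thesis by (simp only: pochhammer_minus p_def mult_ac)
  qed
  define t where "t i = vwp_weight a i * pochhammer (- of_nat l) i * pochhammer (- of_nat n) i /
      (fact i * pochhammer (a + of_nat l) i) *
      ((-1) ^ (n - i) * fact (n - i) *
       (if 3 dvd n - i then ((a + 2 * of_nat n - 1) / 3) gchoose ((n - i) div 3) else 0))" for i

  have "hyp3F2 (- of_nat n) (3 * b / 2) ((1 + 3 * b) / 2) (3 * b + of_nat l) (b - (of_nat n - 2) / 3) (4 / 3) * p =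
      (\<Sum>k\<le>n. pochhammer (- of_nat n) k / fact k * (pochhammer a (2 * k) / pochhammer (a + of_nat l) k) *
        3 ^ (n - k) * pochhammer ((a - of_nat n + 2) / 3 + of_nat k) (n - k))"
    unfolding hyp3F2_terminating sum_distrib_right beta
  proof (rule sum.cong)
    fix k assume "k \<in> {..n}"
    then have k: "k \<le> n" by simp
    have "p = 3 ^ k * 3 ^ (n - k) * (pochhammer ((a - of_nat n + 2) / 3) k *
        pochhammer ((a - of_nat n + 2) / 3 + of_nat k) (n - k))"
      using k by (simp add: p_def pochhammer_product flip: power_add)
    \<comment> \<open>The duplication formula; its 4^k is the numerator of (4/3)^k.\<close>
    moreover have "pochhammer a (2 * k) = 4 ^ k * (pochhammer (3 * b / 2) k * pochhammer ((1 + 3 * b) / 2) k)"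
      using pochhammer_double[of "a / 2" k] by (simp add: a_def power_mult add_divide_distrib add.commute mult.assoc)
    ultimately show "pochhammer (- of_nat n) k * pochhammer (3 * b / 2) k * pochhammer ((1 + 3 * b) / 2) k /
        (fact k * pochhammer (3 * b + of_nat l) k * pochhammer ((a - of_nat n + 2) / 3) k) * (4 / 3) ^ k * p =
        pochhammer (- of_nat n) k / fact k * (pochhammer a (2 * k) / pochhammer (a + of_nat l) k) *
        3 ^ (n - k) * pochhammer ((a - of_nat n + 2) / 3 + of_nat k) (n - k)"
      using nzb[OF k] nzl[OF k] by (simp add: power_divide a_def[symmetric])
  qed simp
  also have "\<dots> = (\<Sum>i\<le>n. t i)"
    unfolding t_def by (rule strange_sum_expansion) (rule nzl)
  \<comment> \<open>The factor (-l)_i vanishes for i > l.\<close>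
  also have "\<dots> = (\<Sum>i\<in>{..min l n}. t i)"
    by (rule sum.mono_neutral_right) (auto simp: t_def pochhammer_of_nat_eq_0_lemma)
  finally have lhs: "hyp3F2 (- of_nat n) (3 * b / 2) ((1 + 3 * b) / 2) (3 * b + of_nat l)
      (b - (of_nat n - 2) / 3) (4 / 3) = (\<Sum>i\<in>{..min l n}. t i) / p"
    using p by (simp add: field_simps)

  define s where "s i = (-1) ^ i / 3 ^ n * ((3 * b - 1 + 2 * of_nat i) / (3 * b - 1)) *
            (pochhammer (- of_nat l) i * pochhammer (- of_nat n) i * pochhammer (3 * b - 1) i /
             (pochhammer 1 i * pochhammer (3 * b + of_nat n) i * pochhammer (3 * b + of_nat l) i)) *
            (sfact (1 / 3) ((int n - int i) div 3) * sfact (2 / 3) ((int n - int i) div 3) /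
             (sfact ((2 - 2 * of_nat n - 3 * b) / 3) ((int n - int i) div 3) *
              sfact ((3 - 2 * of_nat n - 3 * b) / 3) ((int n - int i) div 3))) *
            chi (int n - int i)" for i
  let ?K = "pochhammer (3 * b + of_nat n) n / pochhammer ((1 - 2 * of_nat n) / 3 - b) n"
  \<comment> \<open>The two sums agree term by term. For i \<le> n the integer index (n - i)/3, when
    integral, is nonnegative, so \<open>sfact\<close> reduces to \<open>pochhammer\<close>.\<close>
  have term_eq: "?K * s i = t i / p" if "i \<le> min l n" for i
  proof (cases "3 dvd n - i")
    case False
    moreover have "int n - int i = int (n - i)" using that by simp
    then have "chi (int n - int i) = 0"
      using False by (simp only: chi_def) presburger
    ultimately show ?thesis by (simp add: s_def t_def)
  next
    case True
    then obtain m where "n - i = 3 * m" ..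
    moreover have "i \<le> n" using that by simp
    ultimately have n: "n = i + 3 * m" by linarith
    then have int_n: "int n - int i = 3 * int m" by simp
    have sf: "sfact z ((int n - int i) div 3) = pochhammer z m" for z
      by (simp add: int_n sfact_def)
    have dvd: "3 dvd int n - int i" by (simp add: int_n)
    have "i \<le> l" using that by simp
    note nz = assms(4-8)[OF this dvd, unfolded sf, folded a_def]
    have Q: "fact (3 * m) * (((a + 2 * of_nat n - 1) / 3) gchoose m) =
        pochhammer (a + of_nat n) n / pochhammer (a + of_nat n) i *
        (pochhammer (1 / 3) m * pochhammer (2 / 3) m /
         (pochhammer ((2 - 2 * of_nat n - a) / 3) m * pochhammer ((3 - 2 * of_nat n - a) / 3) m))"
      by (rule fact_gbinomial_eq_pochhammer_quotient[OF n]) (use nz in auto)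
    \<comment> \<open>The condition a \<noteq> 1 is the hypothesis on 3b - 1, available because 3
      divides n - i and i \<le> l.\<close>
    have w: "vwp_weight a i = (a - 1 + 2 * of_nat i) / (a - 1) * pochhammer (a - 1) i"
      using nz by (intro vwp_weight_eq) auto
    have sign: "(-1) ^ i = (-1) ^ n * ((-1) ^ (n - i) :: complex)"
      using n by (simp add: power_add flip: power_mult_distrib)
    have "t i = (-1) ^ (n - i) * (pochhammer (- of_nat l) i * pochhammer (- of_nat n) i / (fact i * pochhammer (a + of_nat l) i)) *
        vwp_weight a i * (fact (3 * m) * (((a + 2 * of_nat n - 1) / 3) gchoose m))"
      using n by (simp add: t_def)
    moreover have "?K * s i = (-1) ^ i / (3 ^ n * pochhammer ((1 - 2 * of_nat n) / 3 - b) n) *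
        (pochhammer (- of_nat l) i * pochhammer (- of_nat n) i / (fact i * pochhammer (a + of_nat l) i)) *
        vwp_weight a i * (fact (3 * m) * (((a + 2 * of_nat n - 1) / 3) gchoose m))"
      unfolding s_def sf Q w a_def[symmetric] using dvd
      by (simp add: chi_def pochhammer_fact mult_ac)
    ultimately show ?thesis
      unfolding prefactor sign by simp
  qed
  \<comment> \<open>For n < i \<le> l the index n - i is negative, and these summands vanish through
    (-n)_i = 0.\<close>
  have "?K * (\<Sum>i = 0..l. s i) = ?K * (\<Sum>i\<in>{..min l n}. s i)"
    by (subst sum.mono_neutral_right[of "{0..l}" "{..min l n}"])
       (auto simp: s_def pochhammer_of_nat_eq_0_lemma)
  also have "\<dots> = (\<Sum>i\<in>{..min l n}. t i) / p"
    unfolding sum_distrib_left sum_divide_distrib by (intro sum.cong refl term_eq) simp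
  finally show ?thesis
    unfolding lhs s_def by (rule sym)
qed

end
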